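(* Let $S$ be a quandle and $T$ a 2-reductive quandle. Let $S/\gamma_S$ be given as the quandle of a 2-reductive mesh $(S_i,s_{i,j})_{i,j\in c(S)}$, where $S_i$ is the component of $S/\gamma_S$ which is the image of the component $i$ of $S$, and let $T$ be given as the quandle of a 2-reductive mesh $(T_i,t_{i,j})_{i,j\in c(T)}$. Then $$|\mathrm{Hom}(S,T)|=\sum_{g:c(S)\to c(T)}\delta_g\prod_{i\in c(S)}|T_{g(i)}|,$$ where the sum is over all maps $g:c(S)\to c(T)$, and $\delta_g=1$ if for each $i\in c(S)$ the assignment $s_{j,i}\mapsto t_{g(j),g(i)}$ ($j\in c(S)$) induces a (well-defined) group homomorphism $S_i\to T_{g(i)}$, and $\delta_g=0$ otherwise.
   Context: A quandle is a set $Q$ with a binary operation $\triangleright$ such that $x\triangleright x=x$; for all $y,z$ there is a unique $x$ with $y\triangleright x=z$ (left divisibility); and $x\triangleright(y\triangleright z)=(x\triangleright y)\triangleright(x\triangleright z)$. It is 2-reductive if $(x\triangleright y)\triangleright z=y\triangleright z$ for all $x,y,z$. $\mathrm{Hom}(S,T)$ is the set of quandle homomorphisms from $S$ to $T$. The components of $Q$ are the orbits of the group generated by the bijections $L_a:x\mapsto a\triangleright x$; $c(Q)$ is the set of components. A congruence on $Q$ is an equivalence relation compatible with $\triangleright$ and with left division, so that the quotient is again a quandle. $\gamma_Q$ is the congruence on $Q$ generated by all pairs $((a\triangleright b)\triangleright c,\ b\triangleright c)$, $a,b,c\in Q$; it is the smallest congruence with 2-reductive quotient. The quotient map induces a bijection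 $c(Q)\to c(Q/\gamma_Q)$, by which $c(Q/\gamma_Q)$ is identified with $c(Q)$. A 2-reductive mesh $(A_i,c_{i,j})_{i,j\in I}$ consists of abelian groups $A_i$ and elements $c_{i,j}\in A_j$ with $c_{i,i}=0$ such that for each $j$ the elements $c_{i,j}$, $i\in I$, generate $A_j$. Its quandle is the disjoint union $\bigcup_i A_i$ with $a\triangleright b=c_{i,j}+b$ for $a\in A_i$, $b\in A_j$. It is known that this is a 2-reductive quandle with components $A_i$, and that every 2-reductive quandle arises this way, with index set its set of components. Thus the component of $T$ named by $j\in c(T)$ is $T_j$. *)

theory Defs
  imports "HOL-Algebra.Bij" "HOL-Algebra.Generated_Groups" "HOL-Algebra.Group_Action"
    "HOL-Library.Equipollence"
begin

record 'a magma = "'a partial_object" +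
  qop :: "'a \<Rightarrow> 'a \<Rightarrow> 'a" (infixl "\<triangleright>\<index>" 70)

locale quandle =
  fixes Q (structure)
  assumes qop_closed: "\<lbrakk>x \<in> carrier Q; y \<in> carrier Q\<rbrakk> \<Longrightarrow> x \<triangleright> y \<in> carrier Q"
    and idem: "x \<in> carrier Q \<Longrightarrow> x \<triangleright> x = x"
    and left_div: "\<lbrakk>y \<in> carrier Q; z \<in> carrier Q\<rbrakk> \<Longrightarrow> \<exists>!x. x \<in> carrier Q \<and> y \<triangleright> x = z"
    and left_dist: "\<lbrakk>x \<in> carrier Q; y \<in> carrier Q; z \<in> carrier Q\<rbrakk>
      \<Longrightarrow> x \<triangleright> (y \<triangleright> z) = (x \<triangleright> y) \<triangleright> (x \<triangleright> z)"

locale two_reductive_quandle = quandle +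
  assumes two_reductive: "\<lbrakk>x \<in> carrier Q; y \<in> carrier Q; z \<in> carrier Q\<rbrakk>
      \<Longrightarrow> (x \<triangleright> y) \<triangleright> z = y \<triangleright> z"

definition ldiv :: "('a, 'm) magma_scheme \<Rightarrow> 'a \<Rightarrow> 'a \<Rightarrow> 'a" where
  "ldiv Q y z = (THE x. x \<in> carrier Q \<and> y \<triangleright>\<^bsub>Q\<^esub> x = z)"

text \<open>Homomorphisms are taken to be extensional, so that each map between the carriers is
  counted once.\<close>
definition quandle_Hom ::
    "('a, 'm) magma_scheme \<Rightarrow> ('b, 'n) magma_scheme \<Rightarrow> ('a \<Rightarrow> 'b) set" where
  "quandle_Hom S T = {f \<in> carrier S \<rightarrow>\<^sub>E carrier T.
     \<forall>x\<in>carrier S. \<forall>y\<in>carrier S. f (x \<triangleright>\<^bsub>S\<^esub> y) = f x \<triangleright>\<^bsub>T\<^esub> f y}"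

definition quandle_iso ::
    "('a, 'm) magma_scheme \<Rightarrow> ('b, 'n) magma_scheme \<Rightarrow> ('a \<Rightarrow> 'b) set" where
  "quandle_iso S T = {f \<in> quandle_Hom S T. bij_betw f (carrier S) (carrier T)}"

definition left_translation :: "('a, 'm) magma_scheme \<Rightarrow> 'a \<Rightarrow> 'a \<Rightarrow> 'a" where
  "left_translation Q a = (\<lambda>x\<in>carrier Q. a \<triangleright>\<^bsub>Q\<^esub> x)"

definition left_mult_group :: "('a, 'm) magma_scheme \<Rightarrow> ('a \<Rightarrow> 'a) monoid" where
  "left_mult_group Q = BijGroup (carrier Q)
     \<lparr>carrier := generate (BijGroup (carrier Q)) (left_translation Q ` carrier Q)\<rparr>"

definition quandle_components :: "('a, 'm) magma_scheme \<Rightarrow> 'a set set" where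
  "quandle_components Q = orbits (left_mult_group Q) (carrier Q) (\<lambda>f. f)"

definition quandle_congruence :: "('a, 'm) magma_scheme \<Rightarrow> ('a \<times> 'a) set \<Rightarrow> bool" where
  "quandle_congruence Q r \<longleftrightarrow> equiv (carrier Q) r \<and>
     (\<forall>x x' y y'. (x, x') \<in> r \<longrightarrow> (y, y') \<in> r \<longrightarrow>
        (x \<triangleright>\<^bsub>Q\<^esub> y, x' \<triangleright>\<^bsub>Q\<^esub> y') \<in> r \<and> (ldiv Q x y, ldiv Q x' y') \<in> r)"

definition gamma :: "('a, 'm) magma_scheme \<Rightarrow> ('a \<times> 'a) set" where
  "gamma Q = \<Inter>{r. quandle_congruence Q r \<and>
     (\<forall>a\<in>carrier Q. \<forall>b\<in>carrier Q. \<forall>c\<in>carrier Q.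
        ((a \<triangleright>\<^bsub>Q\<^esub> b) \<triangleright>\<^bsub>Q\<^esub> c, b \<triangleright>\<^bsub>Q\<^esub> c) \<in> r)}"

definition quandle_quotient ::
    "('a, 'm) magma_scheme \<Rightarrow> ('a \<times> 'a) set \<Rightarrow> 'a set magma" where
  "quandle_quotient Q r = \<lparr>carrier = carrier Q // r,
     qop = (\<lambda>X Y. \<Union>x\<in>X. \<Union>y\<in>Y. r `` {x \<triangleright>\<^bsub>Q\<^esub> y})\<rparr>"

text \<open>The abelian groups are written multiplicatively, as \<^const>\<open>comm_group\<close> requires.\<close>
locale two_reductive_mesh =
  fixes I :: "'i set" and A :: "'i \<Rightarrow> 'c monoid" and c :: "'i \<Rightarrow> 'i \<Rightarrow> 'c"
  assumes comm_group: "i \<in> I \<Longrightarrow> comm_group (A i)"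
    and const_closed: "\<lbrakk>i \<in> I; j \<in> I\<rbrakk> \<Longrightarrow> c i j \<in> carrier (A j)"
    and const_diag: "i \<in> I \<Longrightarrow> c i i = \<one>\<^bsub>A i\<^esub>"
    and const_generate: "j \<in> I \<Longrightarrow> generate (A j) ((\<lambda>i. c i j) ` I) = carrier (A j)"

definition mesh_quandle ::
    "'i set \<Rightarrow> ('i \<Rightarrow> 'c monoid) \<Rightarrow> ('i \<Rightarrow> 'i \<Rightarrow> 'c) \<Rightarrow> ('i \<times> 'c) magma" where
  "mesh_quandle I A c = \<lparr>carrier = (SIGMA i:I. carrier (A i)),
     qop = (\<lambda>(i, a) (j, b). (j, c i j \<otimes>\<^bsub>A j\<^esub> b))\<rparr>"

text \<open>\<open>mesh_presents I A c Q K\<close>: the magma \<open>Q\<close> is given, up to isomorphism, as the quandle of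
  the 2-reductive mesh \<open>(A, c)\<close> over \<open>I\<close>, in such a way that the subset \<open>K i\<close> of \<open>Q\<close> is the
  summand \<open>A i\<close>. The isomorphism is needed because \<open>mesh_quandle\<close> is a tagged disjoint union,
  whereas the index set will itself consist of subsets of a quandle.\<close>
definition mesh_presents ::
    "'i set \<Rightarrow> ('i \<Rightarrow> 'c monoid) \<Rightarrow> ('i \<Rightarrow> 'i \<Rightarrow> 'c) \<Rightarrow>
     ('q, 'm) magma_scheme \<Rightarrow> ('i \<Rightarrow> 'q set) \<Rightarrow> bool" where
  "mesh_presents I A c Q K \<longleftrightarrow> two_reductive_mesh I A c \<and>
     (\<exists>\<phi>\<in>quandle_iso Q (mesh_quandle I A c). \<forall>i\<in>I. \<phi> ` K i = {i} \<times> carrier (A i))"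

definition mesh_delta ::
    "'i set \<Rightarrow> ('i \<Rightarrow> 'c monoid) \<Rightarrow> ('i \<Rightarrow> 'i \<Rightarrow> 'c) \<Rightarrow>
     ('j \<Rightarrow> 'd monoid) \<Rightarrow> ('j \<Rightarrow> 'j \<Rightarrow> 'd) \<Rightarrow> ('i \<Rightarrow> 'j) \<Rightarrow> nat" where
  "mesh_delta I A s B t g =
     (if \<forall>i\<in>I. \<exists>h\<in>hom (A i) (B (g i)). \<forall>j\<in>I. h (s j i) = t (g j) (g i) then 1 else 0)"

text \<open>The number of homomorphisms may be infinite. A sum of cardinals over \<open>g\<close> is then the
  cardinality of a dependent sum \<open>SIGMA g\<close>, a product over \<open>i\<close> that of \<open>PiE\<close>, and the factor
  \<open>\<delta>\<close> that of \<open>{..<\<delta>}\<close>. With finitely many components in the source and a finite target, all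
  these cardinalities are natural numbers and the formula is an equation in \<^typ>\<open>nat\<close>.\<close>

end

theory Submission
  imports Defs
begin

text \<open>Every homomorphism from \<open>S\<close> to the 2-reductive quandle \<open>T\<close> identifies \<open>\<gamma>\<close>-related
  elements, so that \<open>S\<close> and \<open>T\<close> may be replaced by the quandles of the two meshes. Since the
  constants \<open>s j i\<close> generate \<open>A i\<close>, a homomorphism between mesh quandles maps \<open>A i\<close> into a single
  summand \<open>B (g i)\<close>, by a map \<open>u\<close> with \<open>u (s j i b) = t (g j) (g i) u b\<close>. Such a map is a group
  homomorphism taking \<open>s j i\<close> to \<open>t (g j) (g i)\<close> followed by the translation by \<open>u 1\<close>. The
  homomorphism is thus determined by \<open>g\<close> and by the family of the elements \<open>u 1\<close>, which is
  arbitrary.\<close>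

section \<open>Group homomorphisms and generating sets\<close>

text \<open>Serves for uniqueness: the constants \<open>s j i\<close> generate \<open>A i\<close>,
  so a homomorphism witnessing \<open>mesh_delta\<close> at \<open>i\<close> is fixed by its
  prescribed values.\<close>

lemma hom_eq_on_generate:
  assumes "group G" "group H" "h \<in> hom G H" "h' \<in> hom G H" "X \<subseteq> carrier G"
    and eq: "\<And>x. x \<in> X \<Longrightarrow> h x = h' x" and "x \<in> generate G X"
  shows "h x = h' x"
proof -
  interpret h: group_hom G H h
    using assms by (simp add: group_hom_def group_hom_axioms_def)
  interpret h': group_hom G H h'
    using assms by (simp add: group_hom_def group_hom_axioms_def)
  from assms(7) show ?thesis
  proof induction
    case one
    show ?case by simp
  next
    case (incl x)
    then show ?case by (rule eq)
  next
    case (inv x)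
    then have "x \<in> carrier G" using assms(5) by blast
    then show ?case using eq[OF inv] by simp
  next
    case (eng x y)
    then have "x \<in> carrier G" "y \<in> carrier G"
      using group.generate_in_carrier[OF assms(1,5)] by auto
    then show ?case using eng.IH by simp
  qed
qed

text \<open>The elements \<open>x\<close> whose left translation is carried by \<open>u\<close> to
  left translation by some \<open>y\<close> form a subgroup, hence all of \<open>G\<close>. At
  \<open>b = 1\<close> this reads \<open>u x = y \<otimes> u 1\<close>, which determines
  \<open>y\<close> as \<open>u x \<otimes> inv (u 1)\<close>; substituting it makes the normalised
  map multiplicative.\<close>

lemma translate_semi_equivariant_hom:
  assumes "group G" "group H" "X \<subseteq> carrier G" "generate G X = carrier G"
    and u: "\<And>b. b \<in> carrier G \<Longrightarrow> u b \<in> carrier H"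
    and equivariant: "\<And>x. x \<in> X \<Longrightarrow>
      \<exists>y\<in>carrier H. \<forall>b\<in>carrier G. u (x \<otimes>\<^bsub>G\<^esub> b) = y \<otimes>\<^bsub>H\<^esub> u b"
  shows "(\<lambda>b. u b \<otimes>\<^bsub>H\<^esub> inv\<^bsub>H\<^esub> u \<one>\<^bsub>G\<^esub>) \<in> hom G H"
proof -
  interpret G: group G by fact
  interpret H: group H by fact
  have ex: "\<exists>y\<in>carrier H. \<forall>b\<in>carrier G. u (x \<otimes>\<^bsub>G\<^esub> b) = y \<otimes>\<^bsub>H\<^esub> u b"
    if "x \<in> generate G X" for x
    using that
  proof induction
    case one
    show ?case by (rule bexI[of _ "\<one>\<^bsub>H\<^esub>"]) (simp_all add: u)
  next
    case (incl x)
    then show ?case by (rule equivariant)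
  next
    case (inv x)
    then have x: "x \<in> carrier G" using assms(3) by blast
    obtain y where y: "y \<in> carrier H" "\<And>b. b \<in> carrier G \<Longrightarrow> u (x \<otimes>\<^bsub>G\<^esub> b) = y \<otimes>\<^bsub>H\<^esub> u b"
      using equivariant[OF inv] by blast
    have "u (inv\<^bsub>G\<^esub> x \<otimes>\<^bsub>G\<^esub> b) = inv\<^bsub>H\<^esub> y \<otimes>\<^bsub>H\<^esub> u b" if b: "b \<in> carrier G" for b
    proof -
      \<comment> \<open>Equivariance under \<open>x\<close>, applied at
        \<open>inv x \<otimes> b\<close>; cancelling \<open>y\<close> shows that
        \<open>inv x\<close> acts through \<open>inv y\<close>.\<close>
      have "u b = y \<otimes>\<^bsub>H\<^esub> u (inv\<^bsub>G\<^esub> x \<otimes>\<^bsub>G\<^esub> b)"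
        using y(2)[of "inv\<^bsub>G\<^esub> x \<otimes>\<^bsub>G\<^esub> b"] x b by (simp flip: G.m_assoc)
      then show ?thesis
        using y(1) u x b by (simp flip: H.m_assoc)
    qed
    then show ?case using y(1) by (intro bexI[of _ "inv\<^bsub>H\<^esub> y"]) auto
  next
    case (eng x x')
    then have x: "x \<in> carrier G" "x' \<in> carrier G"
      using G.generate_in_carrier[OF assms(3)] by auto
    obtain y where y: "y \<in> carrier H" "\<And>b. b \<in> carrier G \<Longrightarrow> u (x \<otimes>\<^bsub>G\<^esub> b) = y \<otimes>\<^bsub>H\<^esub> u b"
      using eng.IH(1) by blast
    obtain y' where y': "y' \<in> carrier H" "\<And>b. b \<in> carrier G \<Longrightarrow> u (x' \<otimes>\<^bsub>G\<^esub> b) = y' \<otimes>\<^bsub>H\<^esub> u b"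
      using eng.IH(2) by blast
    show ?case
      using x y y' u by (intro bexI[of _ "y \<otimes>\<^bsub>H\<^esub> y'"]) (simp_all add: G.m_assoc H.m_assoc)
  qed
  show ?thesis
  proof (rule homI)
    fix x b assume x: "x \<in> carrier G" and b: "b \<in> carrier G"
    obtain y where y: "y \<in> carrier H" "\<And>b. b \<in> carrier G \<Longrightarrow> u (x \<otimes>\<^bsub>G\<^esub> b) = y \<otimes>\<^bsub>H\<^esub> u b"
      using ex[of x] x assms(4) by blast
    have "u x = y \<otimes>\<^bsub>H\<^esub> u \<one>\<^bsub>G\<^esub>" using y(2)[of "\<one>\<^bsub>G\<^esub>"] x by simp
    then show "u (x \<otimes>\<^bsub>G\<^esub> b) \<otimes>\<^bsub>H\<^esub> inv\<^bsub>H\<^esub> u \<one>\<^bsub>G\<^esub>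
        = u x \<otimes>\<^bsub>H\<^esub> inv\<^bsub>H\<^esub> u \<one>\<^bsub>G\<^esub> \<otimes>\<^bsub>H\<^esub> (u b \<otimes>\<^bsub>H\<^esub> inv\<^bsub>H\<^esub> u \<one>\<^bsub>G\<^esub>)"
      using x b y u by (simp add: H.m_assoc)
  qed (simp add: u)
qed

section \<open>Left division, congruences and \<open>gamma\<close>\<close>

lemma (in quandle) ldiv_props:
  assumes "y \<in> carrier Q" "z \<in> carrier Q"
  shows "ldiv Q y z \<in> carrier Q" "y \<triangleright> ldiv Q y z = z"
  using theI'[OF left_div[OF assms]] by (auto simp: ldiv_def)

lemma (in quandle) ldiv_equality:
  assumes "y \<in> carrier Q" "x \<in> carrier Q" "y \<triangleright> x = z"
  shows "ldiv Q y z = x"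
  using left_div[OF assms(1), of z] ldiv_props[OF assms(1), of z] assms qop_closed by blast

lemma (in quandle) quandle_congruence_gamma: "quandle_congruence Q (gamma Q)"
proof -
  \<comment> \<open>The full relation belongs to the family intersected in \<open>gamma\<close>.
    This keeps the intersection inside the carrier; over an empty family it would be
    \<open>UNIV\<close>. All other closure properties pass to intersections.\<close>
  have "quandle_congruence Q (carrier Q \<times> carrier Q)"
    by (auto simp: quandle_congruence_def qop_closed ldiv_props intro!: equivI refl_onI symI transI)
  then have sub: "gamma Q \<subseteq> carrier Q \<times> carrier Q"
    unfolding gamma_def by (intro Inter_lower) (auto simp: qop_closed)
  have "equiv (carrier Q) (gamma Q)"
  proof (rule equivI)
    show "refl_on (carrier Q) (gamma Q)"
      by (auto intro!: refl_onI simp: gamma_def quandle_congruence_def equiv_def refl_on_def)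
    show "sym (gamma Q)"
      by (rule symI) (auto simp: gamma_def quandle_congruence_def equiv_def dest: symD)
    show "trans (gamma Q)"
      by (rule transI) (auto simp: gamma_def quandle_congruence_def equiv_def dest: transD)
  qed (rule sub)
  then show ?thesis
    unfolding quandle_congruence_def by (auto simp: gamma_def quandle_congruence_def)
qed

lemma quotient_map_Hom:
  assumes "quandle Q" "quandle_congruence Q r"
  shows "(\<lambda>x\<in>carrier Q. r `` {x}) \<in> quandle_Hom Q (quandle_quotient Q r)"
proof -
  interpret quandle Q by fact
  have eq: "equiv (carrier Q) r" using assms(2) by (simp add: quandle_congruence_def)
  \<comment> \<open>The product in the quotient is a union over all pairs of representatives. By
    compatibility all classes in this union coincide, and by reflexivity there is at least
    one.\<close>
  have "(\<Union>x'\<in>r `` {x}. \<Union>y'\<in>r `` {y}. r `` {x' \<triangleright>\<^bsub>Q\<^esub> y'}) = r `` {x \<triangleright>\<^bsub>Q\<^esub> y}"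
    if xy: "x \<in> carrier Q" "y \<in> carrier Q" for x y
  proof -
    have "r `` {x' \<triangleright>\<^bsub>Q\<^esub> y'} = r `` {x \<triangleright>\<^bsub>Q\<^esub> y}" if "x' \<in> r `` {x}" "y' \<in> r `` {y}" for x' y'
    proof -
      have "(x \<triangleright>\<^bsub>Q\<^esub> y, x' \<triangleright>\<^bsub>Q\<^esub> y') \<in> r"
        using assms(2) that by (auto simp: quandle_congruence_def)
      then show ?thesis using equiv_class_eq[OF eq] by blast
    qed
    moreover have "x \<in> r `` {x}" "y \<in> r `` {y}"
      using equiv_class_self[OF eq] xy by auto
    ultimately show ?thesis by blast
  qed
  then show ?thesis
    by (auto simp: quandle_Hom_def quandle_quotient_def qop_closed quotientI)
qed

lemma Hom_kernel_congruence:
  assumes "quandle S" "quandle T" "f \<in> quandle_Hom S T"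
  shows "quandle_congruence S {(x, y). x \<in> carrier S \<and> y \<in> carrier S \<and> f x = f y}"
proof -
  interpret S: quandle S by fact
  interpret T: quandle T by fact
  have f: "f x \<in> carrier T" if "x \<in> carrier S" for x
    using assms(3) that by (auto simp: quandle_Hom_def)
  have op: "f (x \<triangleright>\<^bsub>S\<^esub> y) = f x \<triangleright>\<^bsub>T\<^esub> f y" if "x \<in> carrier S" "y \<in> carrier S" for x y
    using assms(3) that by (auto simp: quandle_Hom_def)
  \<comment> \<open>Applying \<open>f\<close> to \<open>x \<triangleright> ldiv S x y = y\<close>
    shows that \<open>f (ldiv S x y)\<close> solves the division problem in \<open>T\<close>, whose
    solution is unique.\<close>
  have "f (ldiv S x y) = ldiv T (f x) (f y)" if "x \<in> carrier S" "y \<in> carrier S" for x y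
    using op[of x "ldiv S x y"] that
    by (intro T.ldiv_equality[symmetric]) (auto simp: f S.ldiv_props)
  then show ?thesis
    by (auto simp: quandle_congruence_def op S.qop_closed S.ldiv_props
        intro!: equivI refl_onI symI transI)
qed

text \<open>The kernel of \<open>f\<close> is a congruence. It contains the generating pairs of
  \<open>gamma\<close>, since \<open>T\<close> absorbs \<open>f a\<close> in
  \<open>(f a \<triangleright> f b) \<triangleright> f c\<close>. So it is a member of the family
  whose intersection is \<open>gamma S\<close>.\<close>

lemma Hom_respects_gamma:
  assumes "quandle S" "two_reductive_quandle T" "f \<in> quandle_Hom S T" "(x, y) \<in> gamma S"
  shows "f x = f y"
proof -
  interpret S: quandle S by fact
  interpret T: two_reductive_quandle T by fact
  let ?r = "{(x, y). x \<in> carrier S \<and> y \<in> carrier S \<and> f x = f y}"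
  have "quandle_congruence S ?r"
    using assms T.quandle_axioms by (intro Hom_kernel_congruence)
  moreover have "((a \<triangleright>\<^bsub>S\<^esub> b) \<triangleright>\<^bsub>S\<^esub> c, b \<triangleright>\<^bsub>S\<^esub> c) \<in> ?r"
    if "a \<in> carrier S" "b \<in> carrier S" "c \<in> carrier S" for a b c
    using assms(3) that T.two_reductive by (auto simp: quandle_Hom_def S.qop_closed Pi_iff PiE_iff)
  ultimately have "gamma S \<subseteq> ?r"
    unfolding gamma_def by (intro Inter_lower) blast
  then show ?thesis using assms(4) by blast
qed

section \<open>Transfer of Hom sets along surjections and isomorphisms\<close>

lemma Hom_compose:
  assumes "\<And>x y. x \<in> carrier Q \<Longrightarrow> y \<in> carrier Q \<Longrightarrow> x \<triangleright>\<^bsub>Q\<^esub> y \<in> carrier Q"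
    and "f \<in> quandle_Hom Q R" "h \<in> quandle_Hom R T"
  shows "compose (carrier Q) h f \<in> quandle_Hom Q T"
  using assms by (auto simp: quandle_Hom_def compose_def PiE_iff)

text \<open>Precomposition with \<open>p\<close> is the bijection. It is injective because
  \<open>p\<close> is onto, and surjective because each homomorphism out of \<open>S\<close> is
  constant on the fibres of \<open>p\<close> and thus descends to \<open>M\<close>.\<close>

lemma Hom_eqpoll_quotient:
  assumes closed: "\<And>x y. x \<in> carrier S \<Longrightarrow> y \<in> carrier S \<Longrightarrow> x \<triangleright>\<^bsub>S\<^esub> y \<in> carrier S"
    and p: "p \<in> quandle_Hom S M" and surj: "p ` carrier S = carrier M"
    and factor: "\<And>f x y. \<lbrakk>f \<in> quandle_Hom S T; x \<in> carrier S; y \<in> carrier S; p x = p y\<rbrakk>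
      \<Longrightarrow> f x = f y"
  shows "quandle_Hom S T \<approx> quandle_Hom M T"
proof -
  have "bij_betw (\<lambda>f. compose (carrier S) f p) (quandle_Hom M T) (quandle_Hom S T)"
    unfolding bij_betw_def
  proof (intro conjI inj_onI equalityI subsetI)
    fix f f' assume f: "f \<in> quandle_Hom M T" "f' \<in> quandle_Hom M T"
      and eq: "compose (carrier S) f p = compose (carrier S) f' p"
    have "f z = f' z" if "z \<in> carrier M" for z
    proof -
      have "z \<in> p ` carrier S" using that surj by simp
      then obtain x where "x \<in> carrier S" "z = p x" by blast
      then show ?thesis using fun_cong[OF eq, of x] by (simp add: compose_def)
    qed
    moreover have "f \<in> extensional (carrier M)" "f' \<in> extensional (carrier M)"
      using f by (auto simp: quandle_Hom_def PiE_def)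
    ultimately show "f = f'" by (intro extensionalityI)
  next
    fix f assume "f \<in> (\<lambda>f. compose (carrier S) f p) ` quandle_Hom M T"
    then show "f \<in> quandle_Hom S T" using Hom_compose[OF closed p] by blast
  next
    fix f assume f: "f \<in> quandle_Hom S T"
    \<comment> \<open>A section of \<open>p\<close>. The descended map is \<open>f\<close> after
      \<open>q\<close>, and constancy of \<open>f\<close> on fibres makes the choice of preimage
      irrelevant.\<close>
    define q where "q = inv_into (carrier S) p"
    define h where "h = (\<lambda>z\<in>carrier M. f (q z))"
    have q: "q z \<in> carrier S" "p (q z) = z" if "z \<in> carrier M" for z
      using that surj by (auto simp: q_def inv_into_into f_inv_into_f)
    have pc: "p x \<in> carrier M" if "x \<in> carrier S" for x
      using imageI[OF that, of p] by (simp only: surj)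
    have hp: "h (p x) = f x" if "x \<in> carrier S" for x
      using that q pc by (auto simp: h_def intro!: factor[OF f])
    have "h (z \<triangleright>\<^bsub>M\<^esub> w) = h z \<triangleright>\<^bsub>T\<^esub> h w" if "z \<in> carrier M" "w \<in> carrier M" for z w
    proof -
      have "z \<in> p ` carrier S" "w \<in> p ` carrier S" using that surj by simp_all
      then obtain x y where xy: "x \<in> carrier S" "y \<in> carrier S" "z = p x" "w = p y"
        by blast
      have "h (p x \<triangleright>\<^bsub>M\<^esub> p y) = h (p (x \<triangleright>\<^bsub>S\<^esub> y))"
        using p xy by (simp add: quandle_Hom_def)
      also have "\<dots> = f x \<triangleright>\<^bsub>T\<^esub> f y"
        using f xy hp closed by (simp add: quandle_Hom_def)
      finally show ?thesis using xy hp by simp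
    qed
    moreover have "h \<in> carrier M \<rightarrow>\<^sub>E carrier T"
      using f q by (auto simp: h_def quandle_Hom_def PiE_iff)
    ultimately have "h \<in> quandle_Hom M T" by (simp add: quandle_Hom_def)
    moreover have "compose (carrier S) h p = f"
      using f hp by (auto simp: compose_def fun_eq_iff quandle_Hom_def PiE_iff extensional_def)
    ultimately show "f \<in> (\<lambda>f. compose (carrier S) f p) ` quandle_Hom M T" by blast
  qed
  then have "quandle_Hom M T \<approx> quandle_Hom S T" unfolding eqpoll_def by blast
  then show ?thesis by (rule eqpoll_sym)
qed

text \<open>Postcomposition with \<open>\<psi>\<close> is the bijection; its inverse is
  postcomposition with the inverse of \<open>\<psi>\<close>.\<close>

lemma Hom_eqpoll_iso:
  assumes closed: "\<And>x y. x \<in> carrier S \<Longrightarrow> y \<in> carrier S \<Longrightarrow> x \<triangleright>\<^bsub>S\<^esub> y \<in> carrier S"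
    and closedT: "\<And>x y. x \<in> carrier T \<Longrightarrow> y \<in> carrier T \<Longrightarrow> x \<triangleright>\<^bsub>T\<^esub> y \<in> carrier T"
    and psi: "\<psi> \<in> quandle_iso T M"
  shows "quandle_Hom S T \<approx> quandle_Hom S M"
proof -
  have bij: "bij_betw \<psi> (carrier T) (carrier M)" and hom: "\<psi> \<in> quandle_Hom T M"
    using psi by (auto simp: quandle_iso_def)
  have "bij_betw (\<lambda>f. compose (carrier S) \<psi> f) (quandle_Hom S T) (quandle_Hom S M)"
    unfolding bij_betw_def
  proof (intro conjI inj_onI equalityI subsetI)
    fix f f' assume f: "f \<in> quandle_Hom S T" "f' \<in> quandle_Hom S T"
      and eq: "compose (carrier S) \<psi> f = compose (carrier S) \<psi> f'"
    have "f x = f' x" if x: "x \<in> carrier S" for x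
    proof -
      have "\<psi> (f x) = \<psi> (f' x)" using fun_cong[OF eq, of x] x by (simp add: compose_def)
      then show ?thesis
        using bij f x by (auto simp: bij_betw_def quandle_Hom_def dest: inj_onD)
    qed
    moreover have "f \<in> extensional (carrier S)" "f' \<in> extensional (carrier S)"
      using f by (auto simp: quandle_Hom_def PiE_def)
    ultimately show "f = f'" by (intro extensionalityI)
  next
    fix f assume "f \<in> (\<lambda>f. compose (carrier S) \<psi> f) ` quandle_Hom S T"
    then show "f \<in> quandle_Hom S M" using Hom_compose[OF closed _ hom] by blast
  next
    fix f assume f: "f \<in> quandle_Hom S M"
    define q where "q = inv_into (carrier T) \<psi>"
    have q: "q z \<in> carrier T" "\<psi> (q z) = z" if "z \<in> carrier M" for z
      using that bij by (auto simp: q_def bij_betw_def inv_into_into f_inv_into_f)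
    have fM: "f x \<in> carrier M" if "x \<in> carrier S" for x
      using f that by (auto simp: quandle_Hom_def)
    define h where "h = (\<lambda>x\<in>carrier S. q (f x))"
    \<comment> \<open>The inverse of \<open>\<psi>\<close> respects products: both sides lie in
      \<open>carrier T\<close> and have the same image under the injective
      \<open>\<psi>\<close>.\<close>
    have "q (f (x \<triangleright>\<^bsub>S\<^esub> y)) = q (f x) \<triangleright>\<^bsub>T\<^esub> q (f y)" if xy: "x \<in> carrier S" "y \<in> carrier S" for x y
    proof (rule inj_onD[of \<psi> "carrier T"])
      show "inj_on \<psi> (carrier T)" using bij by (simp add: bij_betw_def)
      have "\<psi> (q (f x) \<triangleright>\<^bsub>T\<^esub> q (f y)) = f x \<triangleright>\<^bsub>M\<^esub> f y"
        using hom q fM xy by (simp add: quandle_Hom_def)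
      then show "\<psi> (q (f (x \<triangleright>\<^bsub>S\<^esub> y))) = \<psi> (q (f x) \<triangleright>\<^bsub>T\<^esub> q (f y))"
        using f q(2)[OF fM[OF closed[OF xy]]] xy by (simp add: quandle_Hom_def)
    qed (use xy closed closedT q fM in auto)
    then have "h \<in> quandle_Hom S T"
      using q fM closed by (auto simp: h_def quandle_Hom_def)
    moreover have "compose (carrier S) \<psi> h = f"
      using f q fM by (auto simp: h_def compose_def fun_eq_iff quandle_Hom_def PiE_iff extensional_def)
    ultimately show "f \<in> (\<lambda>f. compose (carrier S) \<psi> f) ` quandle_Hom S T" by blast
  qed
  then show ?thesis unfolding eqpoll_def by blast
qed

section \<open>Homomorphisms between mesh quandles\<close>

text \<open>Since delta is 0 or 1, the factor \<open>{..<mesh_delta I A s B t g}\<close> is empty or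
  \<open>{0}\<close> and acts as a truth value in the dependent sum.\<close>

lemma mem_lessThan_mesh_delta:
  "n \<in> {..<mesh_delta I A s B t g} \<longleftrightarrow> n = 0 \<and>
     (\<forall>i\<in>I. \<exists>h\<in>hom (A i) (B (g i)). \<forall>j\<in>I. h (s j i) = t (g j) (g i))"
  by (auto simp: mesh_delta_def)

lemma two_reductive_mesh_group:
  assumes "two_reductive_mesh I A c" "i \<in> I"
  shows "group (A i)"
  using two_reductive_mesh.comm_group[OF assms] by (rule comm_group.axioms)

text \<open>A product in a mesh quandle lies in the summand of its right factor. So the summand of
  \<open>f (i, b)\<close> does not change when \<open>b\<close> is translated by a constant
  \<open>s j i\<close>, and these translations generate all translations of
  \<open>A i\<close>.\<close>

lemma fst_mesh_Hom:
  assumes mS: "two_reductive_mesh I A s"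
    and f: "f \<in> quandle_Hom (mesh_quandle I A s) (mesh_quandle J B t)"
    and i: "i \<in> I" and b: "b \<in> carrier (A i)"
  shows "fst (f (i, b)) = fst (f (i, \<one>\<^bsub>A i\<^esub>))"
proof -
  interpret group "A i" using two_reductive_mesh_group[OF mS i] .
  have gen: "generate (A i) ((\<lambda>j. s j i) ` I) = carrier (A i)"
    by (rule two_reductive_mesh.const_generate[OF mS i])
  have s: "s j i \<in> carrier (A i)" if "j \<in> I" for j
    using two_reductive_mesh.const_closed[OF mS that i] .
  \<comment> \<open>The left factor of a product acts only through its index, so the unit of
    \<open>A j\<close> can represent the summand \<open>j\<close>.\<close>
  have step: "fst (f (i, s j i \<otimes>\<^bsub>A i\<^esub> b)) = fst (f (i, b))"
    if "j \<in> I" "b \<in> carrier (A i)" for j b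
  proof -
    have "\<one>\<^bsub>A j\<^esub> \<in> carrier (A j)"
      using two_reductive_mesh_group[OF mS that(1)] by (simp add: group.is_monoid)
    then have "f ((j, \<one>\<^bsub>A j\<^esub>) \<triangleright>\<^bsub>mesh_quandle I A s\<^esub> (i, b))
        = f (j, \<one>\<^bsub>A j\<^esub>) \<triangleright>\<^bsub>mesh_quandle J B t\<^esub> f (i, b)"
      using f i that by (simp add: quandle_Hom_def mesh_quandle_def)
    then show ?thesis by (simp add: mesh_quandle_def case_prod_beta)
  qed
  have "\<forall>b\<in>carrier (A i). fst (f (i, x \<otimes>\<^bsub>A i\<^esub> b)) = fst (f (i, b))"
    if "x \<in> generate (A i) ((\<lambda>j. s j i) ` I)" for x
    using that
  proof induction
    case (inv x)
    then obtain j where j: "j \<in> I" "x = s j i" by blast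
    show ?case
    proof
      fix b assume b: "b \<in> carrier (A i)"
      then show "fst (f (i, inv\<^bsub>A i\<^esub> x \<otimes>\<^bsub>A i\<^esub> b)) = fst (f (i, b))"
        using step[OF j(1), of "inv\<^bsub>A i\<^esub> x \<otimes>\<^bsub>A i\<^esub> b"] s[OF j(1)] j(2)
        by (simp flip: m_assoc)
    qed
  next
    case (eng x y)
    then have "x \<in> carrier (A i)" "y \<in> carrier (A i)" using gen by auto
    then show ?case using eng.IH by (simp add: m_assoc)
  qed (use step in auto)
  then have "fst (f (i, b \<otimes>\<^bsub>A i\<^esub> \<one>\<^bsub>A i\<^esub>)) = fst (f (i, \<one>\<^bsub>A i\<^esub>))"
    using gen b by blast
  then show ?thesis using b by simp
qed

text \<open>Applying \<open>f\<close> to the product of \<open>(j, 1)\<close> and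
  \<open>(i, b)\<close> turns translation by \<open>s j i\<close> into translation by
  \<open>t (g j) (g i)\<close>. As the \<open>s j i\<close> generate \<open>A i\<close>,
  \<open>translate_semi_equivariant_hom\<close> yields one homomorphism \<open>h\<close> that serves
  all \<open>j\<close> and \<open>b\<close>.\<close>

lemma mesh_Hom_affine:
  assumes mS: "two_reductive_mesh I A s" and mT: "two_reductive_mesh J B t"
    and f: "f \<in> quandle_Hom (mesh_quandle I A s) (mesh_quandle J B t)"
    and i: "i \<in> I"
  defines "g \<equiv> \<lambda>i. fst (f (i, \<one>\<^bsub>A i\<^esub>))" and "v \<equiv> \<lambda>i. snd (f (i, \<one>\<^bsub>A i\<^esub>))"
  shows "g i \<in> J" "v i \<in> carrier (B (g i))"
    and "\<exists>h\<in>hom (A i) (B (g i)). (\<forall>j\<in>I. h (s j i) = t (g j) (g i)) \<and>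
           (\<forall>b\<in>carrier (A i). f (i, b) = (g i, h b \<otimes>\<^bsub>B (g i)\<^esub> v i))"
proof -
  have one: "\<one>\<^bsub>A j\<^esub> \<in> carrier (A j)" if "j \<in> I" for j
    using two_reductive_mesh_group[OF mS that] by (simp add: group.is_monoid)
  have fc: "f (j, b) \<in> Sigma J (\<lambda>j. carrier (B j))" if "j \<in> I" "b \<in> carrier (A j)" for j b
    using f that by (auto simp: quandle_Hom_def mesh_quandle_def)
  have gJ: "g j \<in> J" if "j \<in> I" for j
    using fc[OF that one[OF that]] by (auto simp: g_def)
  show gi: "g i \<in> J" and vi: "v i \<in> carrier (B (g i))"
    using fc[OF i one[OF i]] by (auto simp: g_def v_def)
  interpret A: group "A i" using two_reductive_mesh_group[OF mS i] .
  interpret B: group "B (g i)" using two_reductive_mesh_group[OF mT gi] .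
  define u where "u b = snd (f (i, b))" for b
  have fst: "fst (f (i, b)) = g i" if "b \<in> carrier (A i)" for b
    using fst_mesh_Hom[OF mS f i that] by (simp add: g_def)
  \<comment> \<open>The first coordinate of \<open>f\<close> is constant on the summand
    \<open>i\<close>, so all values of \<open>u\<close> lie in the single group
    \<open>B (g i)\<close>.\<close>
  have u: "u b \<in> carrier (B (g i))" if "b \<in> carrier (A i)" for b
    using fc[OF i that] fst[OF that] by (auto simp: u_def)
  have s: "s j i \<in> carrier (A i)" if "j \<in> I" for j
    using two_reductive_mesh.const_closed[OF mS that i] .
  have t: "t (g j) (g i) \<in> carrier (B (g i))" if "j \<in> I" for j
    using two_reductive_mesh.const_closed[OF mT gJ[OF that] gi] .
  have equivariant: "u (s j i \<otimes>\<^bsub>A i\<^esub> b) = t (g j) (g i) \<otimes>\<^bsub>B (g i)\<^esub> u b"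
    if "j \<in> I" "b \<in> carrier (A i)" for j b
  proof -
    have "f ((j, \<one>\<^bsub>A j\<^esub>) \<triangleright>\<^bsub>mesh_quandle I A s\<^esub> (i, b))
        = f (j, \<one>\<^bsub>A j\<^esub>) \<triangleright>\<^bsub>mesh_quandle J B t\<^esub> f (i, b)"
      using f i that one[OF that(1)] by (simp add: quandle_Hom_def mesh_quandle_def)
    then show ?thesis
      using fst[OF that(2)] by (simp add: mesh_quandle_def case_prod_beta u_def g_def)
  qed
  define h where "h b = u b \<otimes>\<^bsub>B (g i)\<^esub> inv\<^bsub>B (g i)\<^esub> u \<one>\<^bsub>A i\<^esub>" for b
  have "h \<in> hom (A i) (B (g i))"
    unfolding h_def
  proof (rule translate_semi_equivariant_hom)
    show "generate (A i) ((\<lambda>j. s j i) ` I) = carrier (A i)"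
      by (rule two_reductive_mesh.const_generate[OF mS i])
  qed (use s t u equivariant A.is_group B.is_group in auto)
  moreover have "h (s j i) = t (g j) (g i)" if "j \<in> I" for j
    using equivariant[OF that, of "\<one>\<^bsub>A i\<^esub>"] s[OF that] t[OF that] u
    by (simp add: h_def B.m_assoc)
  moreover have "f (i, b) = (g i, h b \<otimes>\<^bsub>B (g i)\<^esub> v i)" if b: "b \<in> carrier (A i)" for b
  proof -
    have "h b \<otimes>\<^bsub>B (g i)\<^esub> v i = u b"
      using u[OF b] u[of "\<one>\<^bsub>A i\<^esub>"] by (simp add: h_def B.m_assoc u_def v_def)
    then show ?thesis using fst[OF b] by (simp add: prod_eq_iff u_def)
  qed
  ultimately show "\<exists>h\<in>hom (A i) (B (g i)). (\<forall>j\<in>I. h (s j i) = t (g j) (g i)) \<and>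
      (\<forall>b\<in>carrier (A i). f (i, b) = (g i, h b \<otimes>\<^bsub>B (g i)\<^esub> v i))"
    by blast
qed

text \<open>The elements \<open>v i\<close> can be arbitrary: acting multiplies on the left by a
  constant that depends on \<open>g\<close> alone, while \<open>v i\<close> stands on the right of
  \<open>h i b\<close>.\<close>

lemma affine_mesh_Hom:
  assumes mS: "two_reductive_mesh I A s" and mT: "two_reductive_mesh J B t"
    and g: "\<And>i. i \<in> I \<Longrightarrow> g i \<in> J" and v: "\<And>i. i \<in> I \<Longrightarrow> v i \<in> carrier (B (g i))"
    and h: "\<And>i. i \<in> I \<Longrightarrow> h i \<in> hom (A i) (B (g i))"
    and hs: "\<And>i j. \<lbrakk>i \<in> I; j \<in> I\<rbrakk> \<Longrightarrow> h i (s j i) = t (g j) (g i)"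
  shows "(\<lambda>(i, b)\<in>(SIGMA i:I. carrier (A i)). (g i, h i b \<otimes>\<^bsub>B (g i)\<^esub> v i))
      \<in> quandle_Hom (mesh_quandle I A s) (mesh_quandle J B t)"
    (is "?f \<in> _")
proof -
  have hc: "h i b \<in> carrier (B (g i))" if "i \<in> I" "b \<in> carrier (A i)" for i b
    using h that by (auto simp: hom_def)
  have "?f \<in> carrier (mesh_quandle I A s) \<rightarrow>\<^sub>E carrier (mesh_quandle J B t)"
    using g v hc two_reductive_mesh_group[OF mT]
    by (auto simp: mesh_quandle_def intro!: monoid.m_closed group.is_monoid)
  moreover have "?f (x \<triangleright>\<^bsub>mesh_quandle I A s\<^esub> y) = ?f x \<triangleright>\<^bsub>mesh_quandle J B t\<^esub> ?f y"
    if "x \<in> carrier (mesh_quandle I A s)" "y \<in> carrier (mesh_quandle I A s)" for x y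
  proof -
    obtain j a i b where xy: "x = (j, a)" "y = (i, b)" and j: "j \<in> I" "a \<in> carrier (A j)"
      and i: "i \<in> I" and b: "b \<in> carrier (A i)"
      using \<open>x \<in> _\<close> \<open>y \<in> _\<close> by (auto simp: mesh_quandle_def)
    interpret A: group "A i" using two_reductive_mesh_group[OF mS i] .
    interpret B: group "B (g i)" using two_reductive_mesh_group[OF mT g[OF i]] .
    have s: "s j i \<in> carrier (A i)"
      using two_reductive_mesh.const_closed[OF mS j(1) i] .
    have "h i (s j i \<otimes>\<^bsub>A i\<^esub> b) \<otimes>\<^bsub>B (g i)\<^esub> v i
        = t (g j) (g i) \<otimes>\<^bsub>B (g i)\<^esub> (h i b \<otimes>\<^bsub>B (g i)\<^esub> v i)"
      using hom_mult[OF h[OF i] s b] hs[OF i j(1)] hc[OF i s] hc[OF i b] v[OF i]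
      by (simp add: B.m_assoc)
    then show ?thesis using xy i j b s by (simp add: mesh_quandle_def)
  qed
  ultimately show ?thesis by (simp add: quandle_Hom_def)
qed

text \<open>The bijection evaluates \<open>f\<close> at the units: \<open>G f\<close> records the
  summands reached and \<open>V f\<close> the elements in them. The middle entry 0 is the only
  element that the delta factor can have.\<close>

lemma mesh_Hom_eqpoll:
  assumes mS: "two_reductive_mesh I A s" and mT: "two_reductive_mesh J B t"
  shows "quandle_Hom (mesh_quandle I A s) (mesh_quandle J B t) \<approx>
    (SIGMA g : I \<rightarrow>\<^sub>E J. {..<mesh_delta I A s B t g} \<times> (\<Pi>\<^sub>E i\<in>I. carrier (B (g i))))"
    (is "?H \<approx> ?D")
proof -
  define G where "G f = (\<lambda>i\<in>I. fst (f (i, \<one>\<^bsub>A i\<^esub>)))" for f :: "'a \<times> 'b \<Rightarrow> 'c \<times> 'd"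
  define V where "V f = (\<lambda>i\<in>I. snd (f (i, \<one>\<^bsub>A i\<^esub>)))" for f :: "'a \<times> 'b \<Rightarrow> 'c \<times> 'd"
  have affine: "G f i \<in> J" "V f i \<in> carrier (B (G f i))"
    "\<exists>h\<in>hom (A i) (B (G f i)). (\<forall>j\<in>I. h (s j i) = t (G f j) (G f i)) \<and>
       (\<forall>b\<in>carrier (A i). f (i, b) = (G f i, h b \<otimes>\<^bsub>B (G f i)\<^esub> V f i))"
    if "f \<in> ?H" "i \<in> I" for f i
    using mesh_Hom_affine[OF mS mT that] that(2) by (simp_all add: G_def V_def)
  have "bij_betw (\<lambda>f. (G f, 0::nat, V f)) ?H ?D"
    unfolding bij_betw_def
  proof (intro conjI inj_onI equalityI subsetI)
    fix f f' assume f: "f \<in> ?H" and f': "f' \<in> ?H" and "(G f, 0::nat, V f) = (G f', 0, V f')"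
    then have eq: "G f' = G f" "V f' = V f" by auto
    have "f (i, b) = f' (i, b)" if i: "i \<in> I" and b: "b \<in> carrier (A i)" for i b
    proof -
      obtain h where h: "h \<in> hom (A i) (B (G f i))" "\<And>j. j \<in> I \<Longrightarrow> h (s j i) = t (G f j) (G f i)"
        "f (i, b) = (G f i, h b \<otimes>\<^bsub>B (G f i)\<^esub> V f i)"
        using affine(3)[OF f i] b by blast
      obtain h' where h': "h' \<in> hom (A i) (B (G f i))"
        "\<And>j. j \<in> I \<Longrightarrow> h' (s j i) = t (G f j) (G f i)"
        "f' (i, b) = (G f i, h' b \<otimes>\<^bsub>B (G f i)\<^esub> V f i)"
        using affine(3)[OF f' i] b unfolding eq by blast
      \<comment> \<open>Both homomorphisms take the same values on the generating constants, since
        the prescribed values depend only on the common map \<open>G f\<close>.\<close>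
      have "h b = h' b"
      proof (rule hom_eq_on_generate[OF _ _ h(1) h'(1)])
        show "(\<lambda>j. s j i) ` I \<subseteq> carrier (A i)"
          using two_reductive_mesh.const_closed[OF mS _ i] by blast
        show "b \<in> generate (A i) ((\<lambda>j. s j i) ` I)"
          using two_reductive_mesh.const_generate[OF mS i] b by simp
        show "group (A i)" "group (B (G f i))"
          using two_reductive_mesh_group[OF mS i] two_reductive_mesh_group[OF mT affine(1)[OF f i]] .
      qed (use h(2) h'(2) in auto)
      then show ?thesis using h(3) h'(3) by simp
    qed
    moreover have "f \<in> extensional (SIGMA i:I. carrier (A i))"
      "f' \<in> extensional (SIGMA i:I. carrier (A i))"
      using f f' by (auto simp: quandle_Hom_def mesh_quandle_def PiE_def)
    ultimately show "f = f'" by (intro extensionalityI[where A = "SIGMA i:I. carrier (A i)"]) auto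
  next
    fix d assume "d \<in> (\<lambda>f. (G f, 0::nat, V f)) ` ?H"
    then obtain f where f: "f \<in> ?H" and d: "d = (G f, 0, V f)" by blast
    have "G f \<in> I \<rightarrow>\<^sub>E J" using affine(1)[OF f] by (auto simp: G_def)
    moreover have "V f \<in> (\<Pi>\<^sub>E i\<in>I. carrier (B (G f i)))"
      using affine(2)[OF f] by (auto simp: V_def)
    moreover have "0 \<in> {..<mesh_delta I A s B t (G f)}"
      unfolding mem_lessThan_mesh_delta using affine(3)[OF f] by blast
    ultimately show "d \<in> ?D" unfolding d by blast
  next
    fix d assume "d \<in> ?D"
    then obtain g n v where d: "d = (g, n, v)" and g: "g \<in> I \<rightarrow>\<^sub>E J"
      and n: "n \<in> {..<mesh_delta I A s B t g}" and v: "v \<in> (\<Pi>\<^sub>E i\<in>I. carrier (B (g i)))"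
      by blast
    \<comment> \<open>The mere existence of \<open>n\<close> forces delta to be 1, so a homomorphism
      can be chosen for every \<open>i\<close>.\<close>
    obtain h where h: "\<And>i. i \<in> I \<Longrightarrow> h i \<in> hom (A i) (B (g i))"
      "\<And>i j. \<lbrakk>i \<in> I; j \<in> I\<rbrakk> \<Longrightarrow> h i (s j i) = t (g j) (g i)"
      using n unfolding mem_lessThan_mesh_delta by metis
    define f where "f = (\<lambda>(i, b)\<in>(SIGMA i:I. carrier (A i)). (g i, h i b \<otimes>\<^bsub>B (g i)\<^esub> v i))"
    have "f \<in> ?H"
      unfolding f_def using g v by (intro affine_mesh_Hom[OF mS mT _ _ h]) auto
    \<comment> \<open>Each \<open>h i\<close> sends the unit to the unit, so evaluation at the units
      recovers exactly \<open>g\<close> and \<open>v\<close>.\<close>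
    moreover have f1: "f (i, \<one>\<^bsub>A i\<^esub>) = (g i, v i)" if i: "i \<in> I" for i
    proof -
      have gi: "g i \<in> J" using g i by blast
      interpret group_hom "A i" "B (g i)" "h i"
        using two_reductive_mesh_group[OF mS i] two_reductive_mesh_group[OF mT gi] h(1)[OF i]
        by (simp add: group_hom_def group_hom_axioms_def)
      have "v i \<in> carrier (B (g i))" using v i by (rule PiE_mem)
      then show ?thesis using i by (simp add: f_def)
    qed
    have "G f = g" "V f = v"
      using g v f1 by (auto simp: G_def V_def fun_eq_iff PiE_iff extensional_def)
    moreover have "n = 0" using n by (simp only: mem_lessThan_mesh_delta)
    ultimately show "d \<in> (\<lambda>f. (G f, 0::nat, V f)) ` ?H" unfolding d by blast
  qed
  then show ?thesis unfolding eqpoll_def by blast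
qed

section \<open>Finiteness and the final count\<close>

lemma finite_mesh:
  assumes m: "two_reductive_mesh J B t" and fin: "finite (carrier (mesh_quandle J B t))"
  shows "finite J" and "\<And>j. j \<in> J \<Longrightarrow> finite (carrier (B j))"
proof -
  have one: "\<one>\<^bsub>B j\<^esub> \<in> carrier (B j)" if "j \<in> J" for j
    using two_reductive_mesh_group[OF m that] by (simp add: group.is_monoid)
  have fin': "finite (SIGMA j:J. carrier (B j))" using fin by (simp add: mesh_quandle_def)
  \<comment> \<open>Every summand contains its unit, so each index occurs as a first
    coordinate.\<close>
  have "J \<subseteq> fst ` (SIGMA j:J. carrier (B j))" using one by force
  then show "finite J" using fin' by (rule finite_surj[rotated])
  fix j assume "j \<in> J"
  then have "carrier (B j) \<subseteq> snd ` (SIGMA j:J. carrier (B j))" by force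
  then show "finite (carrier (B j))" using fin' by (rule finite_surj[rotated])
qed


theorem corollary3p25:
  fixes S :: "('a, 'm) magma_scheme" and T :: "('b, 'n) magma_scheme"
    and SA :: "'a set \<Rightarrow> 'c monoid" and s :: "'a set \<Rightarrow> 'a set \<Rightarrow> 'c"
    and TA :: "'b set \<Rightarrow> 'd monoid" and t :: "'b set \<Rightarrow> 'b set \<Rightarrow> 'd"
  assumes "quandle S" and "two_reductive_quandle T"
    and "mesh_presents (quandle_components S) SA s
           (quandle_quotient S (gamma S)) (\<lambda>i. (\<lambda>x. gamma S `` {x}) ` i)"
    and "mesh_presents (quandle_components T) TA t T (\<lambda>j. j)"
  shows "quandle_Hom S T \<approx>
           (SIGMA g : quandle_components S \<rightarrow>\<^sub>E quandle_components T.
              {..<mesh_delta (quandle_components S) SA s TA t g} \<times>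
              (\<Pi>\<^sub>E i\<in>quandle_components S. carrier (TA (g i))))
       \<and> (finite (quandle_components S) \<and> finite (carrier T) \<longrightarrow>
           card (quandle_Hom S T) =
           (\<Sum>g \<in> quandle_components S \<rightarrow>\<^sub>E quandle_components T.
              mesh_delta (quandle_components S) SA s TA t g *
              (\<Prod>i\<in>quandle_components S. card (carrier (TA (g i))))))"
proof -
  let ?I = "quandle_components S" and ?J = "quandle_components T"
  let ?MS = "mesh_quandle ?I SA s" and ?MT = "mesh_quandle ?J TA t"
  let ?D = "SIGMA g : ?I \<rightarrow>\<^sub>E ?J. {..<mesh_delta ?I SA s TA t g} \<times>
    (\<Pi>\<^sub>E i\<in>?I. carrier (TA (g i)))"
  interpret S: quandle S by fact
  interpret T: two_reductive_quandle T by fact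
  obtain \<phi> where mS: "two_reductive_mesh ?I SA s"
    and phi: "\<phi> \<in> quandle_Hom (quandle_quotient S (gamma S)) ?MS"
      "bij_betw \<phi> (carrier S // gamma S) (carrier ?MS)"
    using assms(3) by (auto simp: mesh_presents_def quandle_iso_def quandle_quotient_def)
  obtain \<psi> where mT: "two_reductive_mesh ?J TA t" and psi: "\<psi> \<in> quandle_iso T ?MT"
    using assms(4) by (auto simp: mesh_presents_def)
  have equiv: "equiv (carrier S) (gamma S)"
    using S.quandle_congruence_gamma by (simp add: quandle_congruence_def)
  \<comment> \<open>The projection of \<open>S\<close> to its quotient by \<open>gamma S\<close>,
    followed by the identification with the mesh quandle.\<close>
  define p where "p = compose (carrier S) \<phi> (\<lambda>x\<in>carrier S. gamma S `` {x})"
  have p: "p x = \<phi> (gamma S `` {x})" if "x \<in> carrier S" for x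
    using that by (simp add: p_def compose_def)
  have "p \<in> quandle_Hom S ?MS"
    unfolding p_def
    by (rule Hom_compose[OF S.qop_closed quotient_map_Hom[OF assms(1) S.quandle_congruence_gamma]
          phi(1)])
  moreover have "p ` carrier S = carrier ?MS"
  proof -
    have "p ` carrier S = \<phi> ` (carrier S // gamma S)"
      using p by (auto simp: quotient_def image_iff)
    then show ?thesis using phi(2) by (simp add: bij_betw_def)
  qed
  \<comment> \<open>As \<open>\<phi>\<close> is injective, the fibres of \<open>p\<close> are the
    classes of \<open>gamma S\<close>, and \<open>f\<close> is constant on these.\<close>
  moreover have "f x = f y"
    if "f \<in> quandle_Hom S T" "x \<in> carrier S" "y \<in> carrier S" "p x = p y" for f x y
  proof -
    have "gamma S `` {x} = gamma S `` {y}"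
      using phi(2) that p by (auto simp: bij_betw_def quotientI dest: inj_onD)
    then have "(x, y) \<in> gamma S" using eq_equiv_class[OF _ equiv] that(3) by blast
    then show ?thesis using Hom_respects_gamma[OF assms(1,2) that(1)] by blast
  qed
  ultimately have "quandle_Hom S T \<approx> quandle_Hom ?MS T"
    by (intro Hom_eqpoll_quotient[OF S.qop_closed])
  also have "\<dots> \<approx> quandle_Hom ?MS ?MT"
  proof (rule Hom_eqpoll_iso[OF _ T.qop_closed psi])
    fix x y assume "x \<in> carrier ?MS" "y \<in> carrier ?MS"
    then show "x \<triangleright>\<^bsub>?MS\<^esub> y \<in> carrier ?MS"
      using two_reductive_mesh_group[OF mS] two_reductive_mesh.const_closed[OF mS]
      by (auto simp: mesh_quandle_def intro!: monoid.m_closed group.is_monoid)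
  qed
  also have "\<dots> \<approx> ?D" by (rule mesh_Hom_eqpoll[OF mS mT])
  finally have eqp: "quandle_Hom S T \<approx> ?D" .
  moreover have "card (quandle_Hom S T) =
      (\<Sum>g \<in> ?I \<rightarrow>\<^sub>E ?J. mesh_delta ?I SA s TA t g * (\<Prod>i\<in>?I. card (carrier (TA (g i)))))"
    if fin: "finite ?I" "finite (carrier T)"
  proof -
    have "finite (carrier ?MT)"
      using psi fin(2) by (auto simp: quandle_iso_def bij_betw_finite)
    note finT = finite_mesh[OF mT this]
    have "finite (\<Pi>\<^sub>E i\<in>?I. carrier (TA (g i)))" if "g \<in> ?I \<rightarrow>\<^sub>E ?J" for g
      using fin(1) finT(2) that by (intro finite_PiE) auto
    \<comment> \<open>With finitely many maps \<open>g\<close> and finite fibres, the dependent sum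
      is counted fibrewise. The cardinality of \<open>{..<d}\<close> being \<open>d\<close>, each
      fibre contributes delta times a product of cardinalities.\<close>
    then have "card ?D = (\<Sum>g \<in> ?I \<rightarrow>\<^sub>E ?J.
        card ({..<mesh_delta ?I SA s TA t g} \<times> (\<Pi>\<^sub>E i\<in>?I. carrier (TA (g i)))))"
      using fin(1) finT(1) by (intro card_SigmaI finite_PiE ballI) auto
    moreover have "card (quandle_Hom S T) = card ?D"
      using eqp by (auto simp only: eqpoll_def intro: bij_betw_same_card)
    ultimately show ?thesis
      using fin(1) by (simp add: card_cartesian_product card_PiE)
  qed
  ultimately show ?thesis by blast
qed

end
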